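(* Let $V=\mathbb R^n$ and suppose that $r,d$ are integers with $0<r\le n-d\le n$. Let $W\subseteq\bigwedge^r V$ be a linear subspace and $F\in GL_n(\mathbb R)$. Then $$\frac{\dim\left(W\wedge\bigwedge^d V\right)}{\binom{n}{r+d}}\ge\frac{1}{\binom{n}{n-d}}\sum_{J\in\binom{[n]}{n-d}}\frac{\dim\pi^F_J(W)}{\binom{n-d}{r}}.$$
   Context: $[n]=\{1,\dots,n\}$ and $\binom{[n]}{k}$ is the set of $k$-element subsets of $[n]$. For linear subspaces $U,W$ of $\bigwedge V$, $U\wedge W=\operatorname{span}\{u\wedge w:u\in U,w\in W\}$. For $F\in GL_n(\mathbb R)$ with columns $f_1,\dots,f_n$ (a basis of $V$) and $J\subseteq[n]$, let $V_J=\operatorname{span}\{f_j:j\in J\}$ and let $\pi^F_J:V\to V_J$ be the linear projection $\pi^F_J\left(\sum_{j\in[n]}\alpha_jf_j\right)=\sum_{j\in J}\alpha_jf_j$. The same symbol $\pi^F_J:\bigwedge^r V\to\bigwedge^r V_J$ denotes the induced map on exterior powers: with $f_A=\bigwedge_{a\in A}f_a$ (indices increasing), $\pi^F_J(f_A)=f_A$ if $A\subseteq J$ and $0$ otherwise. *)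

theory Defs
  imports "HOL-Analysis.Analysis"
begin

text \<open>
  The exterior algebra of the coordinate space \<open>real ^ 'n\<close>, as the real vector space with one basis
  vector \<open>axis A 1\<close> for every \<open>A :: 'n set\<close>.  This basis vector stands for the product of the
  standard basis vectors \<open>axis a 1\<close>, \<open>a \<in> A\<close>, in increasing order of the indices; see
  \<open>wedge_list_axis\<close>.  Lemmas \<open>wedge_assoc\<close>, \<open>wedge_ext_vec_self\<close> and \<open>wedge_list_axis\<close> say
  that this is the associative algebra of dimension \<open>2 ^ CARD('n)\<close> generated by
  \<open>real ^ 'n\<close> in which every vector squares to zero.
\<close>

type_synonym 'n ext = "real ^ 'n set"

text \<open>The sign of the permutation that sorts an increasing listing of \<open>A\<close> followed by an
  increasing listing of \<open>B\<close> (for disjoint \<open>A\<close>, \<open>B\<close>).\<close>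

definition shuffle_sign :: "'n::linorder set \<Rightarrow> 'n set \<Rightarrow> real" where
  "shuffle_sign A B = (-1) ^ card {(a, b). a \<in> A \<and> b \<in> B \<and> b < a}"

definition wedge :: "'n::{finite,linorder} ext \<Rightarrow> 'n ext \<Rightarrow> 'n ext"  (infixr \<open>\<^bold>\<and>\<close> 70) where
  "u \<^bold>\<and> w = (\<chi> C. \<Sum>A\<in>Pow C. shuffle_sign A (C - A) * u $ A * w $ (C - A))"

definition ext_one :: "'n::{finite,linorder} ext" where
  "ext_one = axis {} 1"

definition ext_vec :: "real ^ 'n::{finite,linorder} \<Rightarrow> 'n ext" where
  "ext_vec v = (\<Sum>i\<in>UNIV. v $ i *\<^sub>R axis {i} 1)"

definition wedge_list :: "(real ^ 'n::{finite,linorder}) list \<Rightarrow> 'n ext" where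
  "wedge_list vs = foldr (\<lambda>v w. ext_vec v \<^bold>\<and> w) vs ext_one"

definition ext_power :: "nat \<Rightarrow> 'n::{finite,linorder} ext set" where
  "ext_power r = span {wedge_list vs | vs. length vs = r}"

definition wedge_space :: "'n::{finite,linorder} ext set \<Rightarrow> 'n ext set \<Rightarrow> 'n ext set" where
  "wedge_space U W = span {u \<^bold>\<and> w | u w. u \<in> U \<and> w \<in> W}"

text \<open>The map on the exterior algebra induced by a linear map; see \<open>ext_map_wedge_list\<close>.\<close>

definition ext_map ::
  "(real ^ 'n::{finite,linorder} \<Rightarrow> real ^ 'n::{finite,linorder}) \<Rightarrow> 'n ext \<Rightarrow> 'n ext" where
  "ext_map T w = (\<Sum>A\<in>UNIV. w $ A *\<^sub>R wedge_list (map (\<lambda>a. T (axis a 1)) (sorted_list_of_set A)))"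

text \<open>\<open>matrix_inv F *v v\<close> is the vector of coordinates of \<open>v\<close> with respect to the columns of \<open>F\<close>;
  see \<open>coord_proj_sum\<close>.\<close>

definition coord_proj :: "real ^ 'n ^ 'n \<Rightarrow> 'n set \<Rightarrow> real ^ 'n \<Rightarrow> real ^ 'n" where
  "coord_proj F J v = (\<Sum>j\<in>J. (matrix_inv F *v v) $ j *\<^sub>R column j F)"

text \<open>See \<open>ext_proj_wedge_columns\<close> for the values on products of columns of \<open>F\<close>.\<close>

definition ext_proj ::
  "real ^ 'n::{finite,linorder} ^ 'n::{finite,linorder} \<Rightarrow> 'n set \<Rightarrow> 'n ext \<Rightarrow> 'n ext" where
  "ext_proj F J = ext_map (coord_proj F J)"

subsection \<open>The algebra structure\<close>

lemma wedge_add_left: "(u + v) \<^bold>\<and> w = u \<^bold>\<and> w + v \<^bold>\<and> w"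
  by (simp add: wedge_def vec_eq_iff algebra_simps sum.distrib)

lemma wedge_add_right: "w \<^bold>\<and> (u + v) = w \<^bold>\<and> u + w \<^bold>\<and> v"
  by (simp add: wedge_def vec_eq_iff algebra_simps sum.distrib)

lemma wedge_scaleR_left [simp]: "(c *\<^sub>R u) \<^bold>\<and> w = c *\<^sub>R (u \<^bold>\<and> w)"
  by (simp add: wedge_def vec_eq_iff sum_distrib_left algebra_simps)

lemma wedge_scaleR_right [simp]: "u \<^bold>\<and> (c *\<^sub>R w) = c *\<^sub>R (u \<^bold>\<and> w)"
  by (simp add: wedge_def vec_eq_iff sum_distrib_left algebra_simps)

lemma linear_wedge_left: "linear (\<lambda>u. u \<^bold>\<and> w)"
  by (rule linearI) (simp_all add: wedge_add_left)

lemma linear_wedge_right: "linear (\<lambda>w. u \<^bold>\<and> w)"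
  by (rule linearI) (simp_all add: wedge_add_right)

lemma wedge_zero_left [simp]: "0 \<^bold>\<and> w = 0"
  using linear_0[OF linear_wedge_left] .

lemma wedge_zero_right [simp]: "u \<^bold>\<and> 0 = 0"
  using linear_0[OF linear_wedge_right] .

lemma linear_axis_eqI:
  fixes f g :: "real ^ 'i \<Rightarrow> 'b::real_vector"
  assumes "linear f" "linear g" "\<And>i. f (axis i 1) = g (axis i 1)"
  shows "f x = g x"
proof -
  have x: "x = (\<Sum>i\<in>UNIV. x $ i *\<^sub>R axis i 1)"
    using basis_expansion[of x] by (simp add: scalar_mult_eq_scaleR)
  show ?thesis
    by (subst (1 2) x) (simp add: linear_sum[OF assms(1)] linear_sum[OF assms(2)]
      linear_scale[OF assms(1)] linear_scale[OF assms(2)] assms(3))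
qed

lemma wedge_axis:
  "axis A 1 \<^bold>\<and> axis B 1
    = (if A \<inter> B = {} then shuffle_sign A B *\<^sub>R axis (A \<union> B) 1 else 0)"
proof -
  have "(axis A 1 \<^bold>\<and> axis B 1) $ C
      = (if A \<inter> B = {} then shuffle_sign A B *\<^sub>R axis (A \<union> B) 1 else 0) $ C" for C
  proof -
    have "(axis A 1 \<^bold>\<and> axis B 1) $ C
        = (\<Sum>D\<in>Pow C. if D = A then shuffle_sign A (C - A) * axis B 1 $ (C - A) else 0)"
      unfolding wedge_def vec_lambda_beta
      by (rule sum.cong) (simp_all add: axis_def)
    also have "\<dots> = (if A \<subseteq> C \<and> C - A = B then shuffle_sign A B else 0)"
      by (simp add: sum.delta' axis_def)
    also have "A \<subseteq> C \<and> C - A = B \<longleftrightarrow> A \<inter> B = {} \<and> C = A \<union> B"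
      by auto
    finally show ?thesis
      by (auto simp: axis_def)
  qed
  then show ?thesis
    by (simp add: vec_eq_iff)
qed

lemma shuffle_sign_Un_left:
  fixes A :: "'n::{finite,linorder} set"
  assumes "A \<inter> B = {}"
  shows "shuffle_sign (A \<union> B) C = shuffle_sign A C * shuffle_sign B C"
proof -
  have "{(a, b). a \<in> A \<union> B \<and> b \<in> C \<and> b < a}
      = {(a, b). a \<in> A \<and> b \<in> C \<and> b < a} \<union> {(a, b). a \<in> B \<and> b \<in> C \<and> b < a}"
    by auto
  moreover have "{(a, b). a \<in> A \<and> b \<in> C \<and> b < a} \<inter> {(a, b). a \<in> B \<and> b \<in> C \<and> b < a} = {}"
    using assms by auto
  ultimately show ?thesis
    by (simp add: shuffle_sign_def card_Un_disjoint power_add)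
qed

lemma shuffle_sign_Un_right:
  fixes A :: "'n::{finite,linorder} set"
  assumes "B \<inter> C = {}"
  shows "shuffle_sign A (B \<union> C) = shuffle_sign A B * shuffle_sign A C"
proof -
  have "{(a, b). a \<in> A \<and> b \<in> B \<union> C \<and> b < a}
      = {(a, b). a \<in> A \<and> b \<in> B \<and> b < a} \<union> {(a, b). a \<in> A \<and> b \<in> C \<and> b < a}"
    by auto
  moreover have "{(a, b). a \<in> A \<and> b \<in> B \<and> b < a} \<inter> {(a, b). a \<in> A \<and> b \<in> C \<and> b < a} = {}"
    using assms by auto
  ultimately show ?thesis
    by (simp add: shuffle_sign_def card_Un_disjoint power_add)
qed

lemma wedge_assoc: "(u \<^bold>\<and> v) \<^bold>\<and> w = u \<^bold>\<and> (v \<^bold>\<and> w)"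
proof -
  have ax: "(axis A 1 \<^bold>\<and> axis B 1) \<^bold>\<and> axis C 1 = axis A 1 \<^bold>\<and> (axis B 1 \<^bold>\<and> axis C 1)"
    for A B C :: "'a set"
  proof (cases "A \<inter> B = {} \<and> A \<inter> C = {} \<and> B \<inter> C = {}")
    case True
    then have "(A \<union> B) \<inter> C = {}" "A \<inter> (B \<union> C) = {}" by auto
    with True show ?thesis
      by (simp add: wedge_axis shuffle_sign_Un_left shuffle_sign_Un_right Un_assoc)
  next
    case False
    then show ?thesis
      by (auto simp: wedge_axis Int_Un_distrib Int_Un_distrib2)
  qed
  note lin = linear_wedge_left linear_wedge_right
    linear_compose[OF linear_wedge_left linear_wedge_right, unfolded o_def]
    linear_compose[OF linear_wedge_right linear_wedge_right, unfolded o_def]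
    linear_compose[OF linear_wedge_left linear_wedge_left, unfolded o_def]
    linear_compose[OF linear_wedge_right linear_wedge_left, unfolded o_def]
  have 1: "(axis A 1 \<^bold>\<and> axis B 1) \<^bold>\<and> w = axis A 1 \<^bold>\<and> (axis B 1 \<^bold>\<and> w)" for A B
    by (rule linear_axis_eqI[where x = w]) (rule lin ax)+
  have 2: "(axis A 1 \<^bold>\<and> v) \<^bold>\<and> w = axis A 1 \<^bold>\<and> (v \<^bold>\<and> w)" for A
    by (rule linear_axis_eqI[where x = v]) (rule lin 1)+
  show ?thesis
    by (rule linear_axis_eqI[where x = u]) (rule lin 2)+
qed

lemma ext_one_wedge [simp]: "ext_one \<^bold>\<and> w = w"
proof (rule linear_axis_eqI[where x = w and g = "\<lambda>w. w"])
  fix A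
  show "ext_one \<^bold>\<and> axis A 1 = axis A 1"
    by (simp add: ext_one_def wedge_axis shuffle_sign_def)
qed (auto intro: linear_wedge_right linear_id[unfolded id_def])

lemma wedge_ext_one [simp]: "w \<^bold>\<and> ext_one = w"
proof (rule linear_axis_eqI[where x = w and g = "\<lambda>w. w"])
  fix A
  show "axis A 1 \<^bold>\<and> ext_one = axis A 1"
    by (simp add: ext_one_def wedge_axis shuffle_sign_def)
qed (auto intro: linear_wedge_left linear_id[unfolded id_def])

lemma linear_ext_vec: "linear ext_vec"
  by (rule linearI) (simp_all add: ext_vec_def scaleR_left_distrib sum.distrib scaleR_sum_right)

lemma ext_vec_axis [simp]: "ext_vec (axis i 1) = axis {i} 1"
proof -
  have "ext_vec (axis i 1) = (\<Sum>j\<in>UNIV. if j = i then axis {j} 1 else (0 :: 'a ext))"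
    unfolding ext_vec_def by (rule sum.cong) (auto simp: axis_def)
  then show ?thesis by simp
qed

lemma wedge_ext_vec_anticommute: "ext_vec u \<^bold>\<and> ext_vec v = - (ext_vec v \<^bold>\<and> ext_vec u)"
proof -
  note lin = linear_compose[OF linear_ext_vec linear_wedge_right, unfolded o_def]
    linear_compose[OF linear_ext_vec linear_wedge_left, unfolded o_def]
  note lin' = lin lin[THEN linear_compose_neg]
  have ax: "ext_vec (axis i 1) \<^bold>\<and> ext_vec (axis j 1)
      = - (ext_vec (axis j 1) \<^bold>\<and> ext_vec (axis i 1))" for i j :: 'a
  proof -
    have "{(a, b). a = i \<and> b = j \<and> b < a} = (if j < i then {(i, j)} else {})"
      "{(a, b). a = j \<and> b = i \<and> b < a} = (if i < j then {(j, i)} else {})"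
      by auto
    then show ?thesis
      by (auto simp: wedge_axis shuffle_sign_def insert_commute)
  qed
  have 1: "ext_vec (axis i 1) \<^bold>\<and> ext_vec v = - (ext_vec v \<^bold>\<and> ext_vec (axis i 1))" for i
    by (rule linear_axis_eqI[where x = v]) (rule lin' ax)+
  show ?thesis
    by (rule linear_axis_eqI[where x = u]) (rule lin' 1)+
qed

lemma wedge_ext_vec_self [simp]: "ext_vec v \<^bold>\<and> ext_vec v = 0"
  using wedge_ext_vec_anticommute[of v v] by (simp add: eq_neg_iff_add_eq_0 flip: scaleR_2)

lemma wedge_list_Nil [simp]: "wedge_list [] = ext_one"
  and wedge_list_Cons [simp]: "wedge_list (v # vs) = ext_vec v \<^bold>\<and> wedge_list vs"
  by (simp_all add: wedge_list_def)

lemma wedge_list_append: "wedge_list (vs @ ws) = wedge_list vs \<^bold>\<and> wedge_list ws"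
  by (induction vs) (simp_all add: wedge_assoc)

lemma wedge_list_axis: "wedge_list (map (\<lambda>a. axis a 1) (sorted_list_of_set A)) = axis A 1"
proof -
  have "wedge_list (map (\<lambda>a. axis a 1) xs) = axis (set xs) 1"
    if "sorted xs" "distinct xs" for xs :: "'a list"
    using that
  proof (induction xs)
    case Nil
    then show ?case by (simp add: ext_one_def)
  next
    case (Cons x xs)
    then have *: "{(a, b). a = x \<and> b \<in> set xs \<and> b < a} = {}"
      by auto
    from Cons show ?case
      by (simp add: wedge_axis shuffle_sign_def *)
  qed
  from this[of "sorted_list_of_set A"] show ?thesis by simp
qed

subsection \<open>Homogeneous components\<close>

lemma wedge_list_nth_eq_0: "card A \<noteq> length vs \<Longrightarrow> wedge_list vs $ A = 0"
proof (induction vs arbitrary: A)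
  case Nil
  then show ?case by (auto simp: ext_one_def axis_def)
next
  case (Cons v vs)
  have "shuffle_sign B (A - B) * ext_vec v $ B * wedge_list vs $ (A - B) = 0" if "B \<subseteq> A" for B
  proof (cases "card B = 1")
    case True
    with that Cons.prems have "card (A - B) \<noteq> length vs"
      using card_mono[OF finite that] by (auto simp: card_Diff_subset)
    then show ?thesis by (simp add: Cons.IH)
  next
    case False
    then have "ext_vec v $ B = 0"
      by (auto simp: ext_vec_def axis_def intro!: sum.neutral)
    then show ?thesis by simp
  qed
  then show ?case
    by (auto simp: wedge_def intro!: sum.neutral)
qed

lemma mem_ext_power_iff: "w \<in> ext_power r \<longleftrightarrow> (\<forall>A. card A \<noteq> r \<longrightarrow> w $ A = 0)"
proof
  assume "w \<in> ext_power r"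
  then show "\<forall>A. card A \<noteq> r \<longrightarrow> w $ A = 0"
    unfolding ext_power_def
    by (induction rule: span_induct_alt) (auto simp: wedge_list_nth_eq_0)
next
  assume w: "\<forall>A. card A \<noteq> r \<longrightarrow> w $ A = 0"
  have "w = (\<Sum>A\<in>UNIV. w $ A *\<^sub>R axis A 1)"
    using basis_expansion[of w] by (simp add: scalar_mult_eq_scaleR)
  also have "\<dots> \<in> ext_power r"
    unfolding ext_power_def
  proof (rule span_sum)
    fix A :: "'a set"
    show "w $ A *\<^sub>R axis A 1 \<in> span {wedge_list vs | vs. length vs = r}"
    proof (cases "card A = r")
      case True
      then have "axis A (1 :: real) \<in> {wedge_list vs | vs. length vs = r}"
        by (auto intro!: exI[of _ "map (\<lambda>a. axis a 1) (sorted_list_of_set A)"]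
            simp: wedge_list_axis)
      then show ?thesis by (intro span_scale span_base)
    qed (use w in \<open>auto simp: span_zero\<close>)
  qed
  finally show "w \<in> ext_power r" .
qed

subsection \<open>Induced maps and projections\<close>

lemma linear_ext_map: "linear (ext_map T)"
  by (rule linearI) (simp_all add: ext_map_def scaleR_left_distrib sum.distrib scaleR_sum_right)

lemma ext_map_axis:
  "ext_map T (axis A 1) = wedge_list (map (\<lambda>a. T (axis a 1)) (sorted_list_of_set A))"
proof -
  have "ext_map T (axis A 1) = (\<Sum>B\<in>UNIV. if B = A
      then wedge_list (map (\<lambda>a. T (axis a 1)) (sorted_list_of_set B)) else 0)"
    unfolding ext_map_def by (rule sum.cong) (auto simp: axis_def)
  then show ?thesis by simp
qed

lemma wedge_list_insort:
  assumes "sorted xs" "distinct xs"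
  shows "ext_vec (g a) \<^bold>\<and> wedge_list (map g xs)
    = (if a \<in> set xs then 0
       else (-1) ^ card {b \<in> set xs. b < a} *\<^sub>R wedge_list (map g (insort a xs)))"
  using assms
proof (induction xs)
  case Nil
  then show ?case by simp
next
  case (Cons b ys)
  consider "a = b" | "a < b" | "b < a" by fastforce
  then show ?case
  proof cases
    case 1
    then show ?thesis by (simp flip: wedge_assoc)
  next
    case 2
    with Cons.prems have "{c \<in> set (b # ys). c < a} = {}" "a \<notin> set (b # ys)"
      by auto
    moreover have "insort a (b # ys) = a # b # ys"
      using 2 by (simp add: less_imp_le)
    ultimately show ?thesis
      by (simp only: if_False card.empty) simp
  next
    case 3
    have eq: "ext_vec (g a) \<^bold>\<and> wedge_list (map g (b # ys))
        = - (ext_vec (g b) \<^bold>\<and> (ext_vec (g a) \<^bold>\<and> wedge_list (map g ys)))"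
      using wedge_ext_vec_anticommute[of "g a" "g b"]
        linear_neg[OF linear_wedge_left[of "wedge_list (map g ys)"]]
      by (simp flip: wedge_assoc)
    have "{c \<in> set (b # ys). c < a} = insert b {c \<in> set ys. c < a}"
      using 3 by auto
    moreover have "b \<notin> {c \<in> set ys. c < a}"
      using Cons.prems by auto
    ultimately have "card {c \<in> set (b # ys). c < a} = Suc (card {c \<in> set ys. c < a})"
      by simp
    with 3 Cons show ?thesis
      unfolding eq by auto
  qed
qed

lemma ext_map_ext_vec_wedge:
  assumes "linear T"
  shows "ext_map T (ext_vec v \<^bold>\<and> w) = ext_vec (T v) \<^bold>\<and> ext_map T w"
proof -
  have ax: "ext_map T (ext_vec (axis a 1) \<^bold>\<and> axis B 1)
      = ext_vec (T (axis a 1)) \<^bold>\<and> ext_map T (axis B 1)" for a B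
  proof (cases "a \<in> B")
    case True
    then show ?thesis
      using wedge_list_insort[of "sorted_list_of_set B" "\<lambda>a. T (axis a 1)" a]
      by (simp add: ext_map_axis wedge_axis linear_0[OF linear_ext_map])
  next
    case False
    have "{(x, b). x = a \<and> b \<in> B \<and> b < x} = Pair a ` {b \<in> B. b < a}"
      by auto
    then have "card {(x, b). x = a \<and> b \<in> B \<and> b < x} = card {b \<in> B. b < a}"
      by (simp add: card_image inj_on_def)
    with False show ?thesis
      using wedge_list_insort[of "sorted_list_of_set B" "\<lambda>a. T (axis a 1)" a]
      by (simp add: ext_map_axis wedge_axis shuffle_sign_def linear_scale[OF linear_ext_map]
          sorted_list_of_set_insert_remove)
  qed
  have 1: "ext_map T (ext_vec (axis a 1) \<^bold>\<and> w) = ext_vec (T (axis a 1)) \<^bold>\<and> ext_map T w" for a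
    by (rule linear_axis_eqI[where x = w])
       (rule linear_compose[OF linear_wedge_right linear_ext_map, unfolded o_def]
          linear_compose[OF linear_ext_map linear_wedge_right, unfolded o_def] ax)+
  show ?thesis
    by (rule linear_axis_eqI[where x = v])
       (rule linear_compose[OF linear_compose[OF linear_ext_vec linear_wedge_left]
            linear_ext_map, unfolded o_def]
          linear_compose[OF linear_compose[OF assms linear_ext_vec] linear_wedge_left,
            unfolded o_def] 1)+
qed

lemma ext_map_wedge_list:
  assumes "linear T"
  shows "ext_map T (wedge_list vs) = wedge_list (map T vs)"
proof (induction vs)
  case Nil
  then show ?case
    using ext_map_axis[of T "{}"] by (simp add: ext_one_def)
qed (simp add: ext_map_ext_vec_wedge[OF assms])

lemma linear_coord_proj: "linear (coord_proj F J)"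
  by (rule linearI) (simp_all add: coord_proj_def matrix_vector_right_distrib
      matrix_vector_mult_scaleR scaleR_left_distrib sum.distrib scaleR_sum_right)

lemma coord_proj_sum:
  fixes F :: "real ^ 'n ^ 'n"
  assumes "invertible F"
  shows "coord_proj F J (\<Sum>j\<in>UNIV. c j *\<^sub>R column j F) = (\<Sum>j\<in>J. c j *\<^sub>R column j F)"
proof -
  have "(\<Sum>j\<in>UNIV. c j *\<^sub>R column j F) = F *v (\<chi> j. c j)"
    by (simp add: matrix_mult_sum scalar_mult_eq_scaleR)
  moreover have "matrix_inv F ** F = mat 1"
    using someI_ex[OF assms[unfolded invertible_def]] by (simp add: matrix_inv_def)
  then have "matrix_inv F *v (F *v x) = x" for x
    by (simp add: matrix_vector_mul_assoc)
  ultimately show ?thesis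
    by (simp add: coord_proj_def)
qed

lemma coord_proj_column:
  fixes F :: "real ^ 'n ^ 'n"
  assumes "invertible F"
  shows "coord_proj F J (column i F) = (if i \<in> J then column i F else 0)"
proof -
  have "(\<Sum>j\<in>S. (if j = i then 1 else 0) *\<^sub>R column j F)
      = (if i \<in> S then column i F else 0)" for S
    by (simp add: if_distrib[of "\<lambda>x. x *\<^sub>R _"] sum.delta' cong: if_cong)
  with coord_proj_sum[OF assms, of J "\<lambda>j. if j = i then 1 else 0"] show ?thesis
    by simp
qed

lemma ext_proj_wedge_columns:
  assumes "invertible F"
  defines "f \<equiv> \<lambda>A. wedge_list (map (\<lambda>a. column a F) (sorted_list_of_set A))"
  shows "ext_proj F J (f A) = (if A \<subseteq> J then f A else 0)"
proof -
  have zero: "wedge_list vs = 0" if "0 \<in> set vs" for vs :: "(real ^ 'a::{finite,linorder}) list"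
    using that by (induction vs) (auto simp: linear_0[OF linear_ext_vec])
  have "ext_proj F J (f A)
      = wedge_list (map (\<lambda>a. if a \<in> J then column a F else 0) (sorted_list_of_set A))"
    by (simp add: ext_proj_def f_def ext_map_wedge_list[OF linear_coord_proj] o_def
        coord_proj_column[OF assms(1)])
  also have "\<dots> = (if A \<subseteq> J then f A else 0)"
  proof (cases "A \<subseteq> J")
    case True
    then have "map (\<lambda>a. if a \<in> J then column a F else 0) (sorted_list_of_set A)
        = map (\<lambda>a. column a F) (sorted_list_of_set A)"
      by auto
    with True show ?thesis by (simp only: f_def if_True)
  next
    case False
    then show ?thesis by (auto intro!: zero)
  qed
  finally show ?thesis .
qed

end

theory Submission
  imports Defs
begin

text \<open>
  Fix a \<open>d\<close>-set \<open>D\<close> with complement \<open>J\<close> and write \<open>f\<^sub>A\<close> for the product of the columns of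
  \<open>F\<close> indexed by \<open>A\<close>.  Multiplication by \<open>f\<^sub>D\<close> kills exactly those basis elements \<open>f\<^sub>A\<close> with
  \<open>A\<close> not inside \<open>J\<close>, and sends the others, up to sign, to distinct basis elements
  \<open>f\<^bsub>A \<union> D\<^esub>\<close>.  So the subspace \<open>W \<and> f\<^sub>D\<close> of \<open>U = W \<and> \<Lambda>\<^sup>d V\<close> has the same dimension as the
  projection of \<open>W\<close> to \<open>J\<close>, and it is supported on the basis elements \<open>f\<^sub>C\<close> with
  \<open>D \<subseteq> C\<close> and \<open>card C = r + d\<close>.

  These subspaces, one for each \<open>D\<close>, overlap, and the overlap is controlled by a set \<open>I\<close> of
  at most \<open>dim U\<close> coordinates that determine the elements of \<open>U\<close> (\<open>determining_coordinates\<close>).  An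
  element of \<open>U\<close> that is supported on \<open>S\<close> is already determined by its coordinates in
  \<open>I \<inter> S\<close>; hence \<open>dim (W \<and> f\<^sub>D)\<close> is at most the number of \<open>C \<in> I\<close> of size \<open>r + d\<close>
  that contain \<open>D\<close> (\<open>dim_coordinate_proj_le\<close>).  Every such \<open>C\<close> contains \<open>r + d choose d\<close>
  sets \<open>D\<close>, so double counting bounds the sum of the projected dimensions by
  \<open>dim U * (r + d choose d)\<close>.  The claim follows from
  \<open>(n choose r + d) * (r + d choose d) = (n choose d) * (n - d choose r)\<close>.

  The basis \<open>f\<^sub>A\<close> is the image of the standard basis under the algebra automorphism induced by
  \<open>F\<close>, and so the argument can be carried out in standard coordinates.
\<close>

section \<open>Coordinates that determine a subspace\<close>

text \<open>Induction on the dimension: a coordinate \<open>i\<close> that does not vanish on \<open>U\<close> cuts out a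
  hyperplane of \<open>U\<close>, and \<open>i\<close> together with a determining set for that hyperplane determines
  \<open>U\<close>.\<close>

lemma determining_coordinates:
  fixes U :: "(real ^ 'i) set"
  assumes "subspace U"
  obtains I where "card I \<le> dim U"
    and "\<And>u. u \<in> U \<Longrightarrow> (\<And>i. i \<in> I \<Longrightarrow> u $ i = 0) \<Longrightarrow> u = 0"
proof -
  have "\<exists>I. card I \<le> dim U \<and> (\<forall>u\<in>U. (\<forall>i\<in>I. u $ i = 0) \<longrightarrow> u = 0)"
    using assms
  proof (induction "dim U" arbitrary: U rule: less_induct)
    case less
    show ?case
    proof (cases "U \<subseteq> {0}")
      case True
      then show ?thesis
        by (intro exI[of _ "{}"]) auto
    next
      case False
      then obtain u i where u: "u \<in> U" "u $ i \<noteq> 0"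
        by (force simp: vec_eq_iff)
      define U' where "U' = U \<inter> {x. x $ i = 0}"
      have sub: "subspace U'"
        unfolding U'_def using less.prems by (auto simp: subspace_def)
      have "u \<notin> U'"
        using u by (simp add: U'_def)
      with u have "U' \<subset> U"
        by (auto simp: U'_def)
      then have dim: "dim U' < dim U"
        using sub less.prems by (metis dim_psubset span_eq_iff)
      from less.hyps[OF dim sub] obtain I where
        I: "card I \<le> dim U'" "\<forall>u\<in>U'. (\<forall>i\<in>I. u $ i = 0) \<longrightarrow> u = 0"
        by blast
      have "card (insert i I) \<le> dim U"
        using I(1) dim card_insert_le_m1[of "dim U" I i] by auto
      moreover have "\<forall>u\<in>U. (\<forall>k\<in>insert i I. u $ k = 0) \<longrightarrow> u = 0"
        using I(2) by (auto simp: U'_def)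
      ultimately show ?thesis
        by blast
    qed
  qed
  then show ?thesis
    using that by blast
qed

text \<open>On \<open>X\<close> all coordinates in \<open>I - S\<close> vanish, so the restriction to \<open>I \<inter> S\<close> embeds \<open>X\<close> into a
  space of dimension \<open>card (I \<inter> S)\<close>.\<close>

lemma dim_supported_le:
  fixes X :: "(real ^ 'i) set"
  assumes "subspace X"
    and det: "\<And>u. u \<in> X \<Longrightarrow> (\<And>i. i \<in> I \<Longrightarrow> u $ i = 0) \<Longrightarrow> u = 0"
    and supp: "\<And>u i. u \<in> X \<Longrightarrow> i \<notin> S \<Longrightarrow> u $ i = 0"
  shows "dim X \<le> card (I \<inter> S)"
proof -
  define R :: "real ^ 'i \<Rightarrow> real ^ 'i" where "R u = (\<Sum>i\<in>I \<inter> S. u $ i *\<^sub>R axis i 1)" for u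
  have lin: "linear R"
    by (rule linearI) (simp_all add: R_def scaleR_left_distrib sum.distrib scaleR_sum_right)
  have nth: "R u $ k = (if k \<in> I \<inter> S then u $ k else 0)" for u k
  proof -
    have "R u $ k = (\<Sum>i\<in>I \<inter> S. if i = k then u $ i else 0)"
      unfolding R_def sum_component by (rule sum.cong) (auto simp: axis_def)
    then show ?thesis
      by (simp add: sum.delta)
  qed
  have "u = 0" if "u \<in> X" "R u = 0" for u
  proof (rule det[OF that(1)])
    fix i
    assume "i \<in> I"
    with nth[of u i] that supp[of u i] show "u $ i = 0"
      by (cases "i \<in> S") auto
  qed
  then have "inj_on R (span X)"
    using assms(1) by (simp add: linear_injective_on_subspace_0[OF lin] span_eq_iff[THEN iffD2])
  then have "dim X = dim (R ` X)"
    using dim_image_eq[OF lin] by simp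
  also have "R ` X \<subseteq> span ((\<lambda>i. axis i 1) ` (I \<inter> S))"
    unfolding R_def by (auto intro!: span_sum span_scale intro: span_base)
  then have "dim (R ` X) \<le> card ((\<lambda>i. axis i (1 :: real)) ` (I \<inter> S))"
    by (intro dim_le_card) auto
  also have "\<dots> \<le> card (I \<inter> S)"
    by (rule card_image_le) simp
  finally show ?thesis .
qed

section \<open>Induced maps are algebra homomorphisms\<close>

lemma ext_map_wedge:
  assumes "linear T"
  shows "ext_map T (u \<^bold>\<and> w) = ext_map T u \<^bold>\<and> ext_map T w"
proof -
  have ax: "ext_map T (axis A 1 \<^bold>\<and> axis B 1) = ext_map T (axis A 1) \<^bold>\<and> ext_map T (axis B 1)"
    for A B
    unfolding wedge_list_axis[symmetric]
    by (simp add: ext_map_wedge_list[OF assms] flip: wedge_list_append)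
  note lin = linear_compose[OF linear_wedge_left linear_ext_map, unfolded o_def]
    linear_compose[OF linear_wedge_right linear_ext_map, unfolded o_def]
    linear_compose[OF linear_ext_map linear_wedge_left, unfolded o_def]
    linear_compose[OF linear_ext_map linear_wedge_right, unfolded o_def]
  have 1: "ext_map T (axis A 1 \<^bold>\<and> w) = ext_map T (axis A 1) \<^bold>\<and> ext_map T w" for A
    by (rule linear_axis_eqI[where x = w]) (rule lin ax)+
  show ?thesis
    by (rule linear_axis_eqI[where x = u]) (rule lin 1)+
qed

lemma ext_map_in_ext_power:
  assumes "linear T" "w \<in> ext_power r"
  shows "ext_map T w \<in> ext_power r"
proof -
  have "ext_map T ` {wedge_list vs | vs. length vs = r} \<subseteq> {wedge_list vs | vs. length vs = r}"
    by (force simp: ext_map_wedge_list[OF assms(1)])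
  then have "span (ext_map T ` {wedge_list vs | vs. length vs = r}) \<subseteq> ext_power r"
    unfolding ext_power_def by (rule span_mono)
  with assms(2) show ?thesis
    by (auto simp: ext_power_def linear_span_image[OF linear_ext_map])
qed

lemma ext_map_inverse:
  fixes T S :: "real ^ 'n::{finite,linorder} \<Rightarrow> real ^ 'n::{finite,linorder}"
  assumes "linear S" and "\<And>v. S (T v) = v"
  shows "ext_map S (ext_map T w) = w"
proof (rule linear_axis_eqI[where x = w and g = "\<lambda>w. w"])
  fix A :: "'n set"
  show "ext_map S (ext_map T (axis A 1)) = axis A 1"
    by (simp add: ext_map_axis ext_map_wedge_list[OF assms(1)] o_def assms(2) wedge_list_axis)
qed (auto intro: linear_compose[OF linear_ext_map linear_ext_map, unfolded o_def]
  linear_id[unfolded id_def])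

section \<open>Projections as multiplications\<close>

lemma wedge_axis_nth:
  "(u \<^bold>\<and> axis D 1) $ C = (if D \<subseteq> C then shuffle_sign (C - D) D * u $ (C - D) else 0)"
proof -
  have "(u \<^bold>\<and> axis D 1) $ C
      = (\<Sum>A\<in>Pow C. if A = C - D \<and> D \<subseteq> C then shuffle_sign A D * u $ A else 0)"
    unfolding wedge_def vec_lambda_beta
  proof (rule sum.cong)
    fix A
    assume "A \<in> Pow C"
    then have "C - A = D \<longleftrightarrow> A = C - D \<and> D \<subseteq> C"
      by auto
    then show "shuffle_sign A (C - A) * u $ A * axis D 1 $ (C - A)
        = (if A = C - D \<and> D \<subseteq> C then shuffle_sign A D * u $ A else 0)"
      by (auto simp: axis_def)
  qed simp
  also have "\<dots> = (if D \<subseteq> C then shuffle_sign (C - D) D * u $ (C - D) else 0)"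
    by (cases "D \<subseteq> C") (auto simp: sum.delta')
  finally show ?thesis .
qed

definition restrict_ext :: "'n::{finite,linorder} set \<Rightarrow> 'n::{finite,linorder} ext \<Rightarrow> 'n ext" where
  "restrict_ext J w = (\<chi> A. if A \<subseteq> J then w $ A else 0)"

lemma linear_restrict_ext: "linear (restrict_ext J)"
  by (rule linearI) (auto simp: restrict_ext_def vec_eq_iff)

lemma restrict_ext_axis: "restrict_ext J (axis A 1) = (if A \<subseteq> J then axis A 1 else 0)"
  by (auto simp: restrict_ext_def vec_eq_iff axis_def)

text \<open>The automorphism induced by \<open>F\<close> carries the standard basis to the products of columns,
  and therefore conjugates restriction of coordinates into the projection along \<open>F\<close>.\<close>

lemma ext_proj_ext_map:
  assumes "invertible F"
  shows "ext_proj F J (ext_map ((*v) F) w) = ext_map ((*v) F) (restrict_ext J w)"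
proof (rule linear_axis_eqI[where x = w])
  show "linear (\<lambda>w. ext_proj F J (ext_map ((*v) F) w))"
    unfolding ext_proj_def by (rule linear_compose[OF linear_ext_map linear_ext_map, unfolded o_def])
  show "linear (\<lambda>w. ext_map ((*v) F) (restrict_ext J w))"
    by (rule linear_compose[OF linear_restrict_ext linear_ext_map, unfolded o_def])
  show "ext_proj F J (ext_map ((*v) F) (axis A 1)) = ext_map ((*v) F) (restrict_ext J (axis A 1))"
    for A
    using ext_proj_wedge_columns[OF assms, of J A]
    by (simp add: ext_map_axis restrict_ext_axis matrix_vector_mult_basis
        linear_0[OF linear_ext_map])
qed

text \<open>Multiplication by the basis vector of \<open>D\<close> factors through the restriction to \<open>- D\<close>, and on
  the image of that restriction it only relabels coordinates and changes signs.\<close>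

lemma dim_restrict_ext_eq_dim_wedge:
  assumes "subspace W"
  shows "dim (restrict_ext (- D) ` W) = dim ((\<lambda>u. u \<^bold>\<and> axis D 1) ` W)"
proof -
  let ?m = "\<lambda>u. u \<^bold>\<and> axis D 1"
  have eq: "?m (restrict_ext (- D) u) = ?m u" for u
    by (auto simp: vec_eq_iff wedge_axis_nth restrict_ext_def)
  have sub: "subspace (restrict_ext (- D) ` W)"
    by (rule linear_subspace_image[OF linear_restrict_ext assms])
  have "x = 0" if x: "x \<in> restrict_ext (- D) ` W" and 0: "?m x = 0" for x
  proof -
    have "x $ A = 0" for A
    proof (cases "A \<subseteq> - D")
      case True
      then have "A \<union> D - D = A"
        by auto
      moreover have "?m x $ (A \<union> D) = 0"
        by (simp add: 0)
      ultimately show ?thesis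
        by (simp add: wedge_axis_nth shuffle_sign_def)
    next
      case False
      from x obtain w where "x = restrict_ext (- D) w"
        by blast
      with False show ?thesis
        by (simp only: restrict_ext_def vec_lambda_beta if_False)
    qed
    then show ?thesis
      by (simp add: vec_eq_iff)
  qed
  then have "inj_on ?m (span (restrict_ext (- D) ` W))"
    using sub
    by (simp add: linear_injective_on_subspace_0[OF linear_wedge_left] span_eq_iff[THEN iffD2])
  then have "dim (restrict_ext (- D) ` W) = dim (?m ` restrict_ext (- D) ` W)"
    using dim_image_eq[OF linear_wedge_left] by metis
  then show ?thesis
    by (simp add: image_image eq)
qed

section \<open>The inequality\<close>

text \<open>The projection has the dimension of the space of products \<open>u \<^bold>\<and> axis D 1\<close>.  These products are
  homogeneous of degree \<open>r + d\<close> and supported on sets containing \<open>D\<close>, so only such members of a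
  determining set \<open>I\<close> matter.\<close>

lemma dim_coordinate_proj_le:
  assumes "subspace W" "W \<subseteq> ext_power r" "card D = d"
    and "\<And>u. u \<in> W \<Longrightarrow> (\<And>C. C \<in> I \<Longrightarrow> (u \<^bold>\<and> axis D 1) $ C = 0) \<Longrightarrow> u \<^bold>\<and> axis D 1 = 0"
  shows "dim (restrict_ext (- D) ` W) \<le> card (I \<inter> {C. D \<subseteq> C \<and> card C = r + d})"
  unfolding dim_restrict_ext_eq_dim_wedge[OF assms(1)]
proof (rule dim_supported_le)
  show "subspace ((\<lambda>u. u \<^bold>\<and> axis D 1) ` W)"
    by (rule linear_subspace_image[OF linear_wedge_left assms(1)])
next
  fix x C
  assume "x \<in> (\<lambda>u. u \<^bold>\<and> axis D 1) ` W" and C: "C \<notin> {C. D \<subseteq> C \<and> card C = r + d}"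
  then obtain u where u: "u \<in> W" "x = u \<^bold>\<and> axis D 1"
    by blast
  show "x $ C = 0"
  proof (cases "D \<subseteq> C")
    case True
    then have "card C = card (C - D) + d"
      using assms(3) card_mono[OF finite True] by (simp add: card_Diff_subset)
    with C True have "card (C - D) \<noteq> r"
      by auto
    with u(1) assms(2) have "u $ (C - D) = 0"
      by (auto simp: mem_ext_power_iff)
    then show ?thesis
      by (simp add: u wedge_axis_nth)
  qed (simp add: u wedge_axis_nth)
qed (use assms(4) in blast)

lemma sum_card_containing_le:
  fixes I :: "'a::finite set set"
  shows "(\<Sum>D | card D = d. card (I \<inter> {C. D \<subseteq> C \<and> card C = m})) \<le> card I * (m choose d)"
proof -
  have "(\<Sum>D | card D = d. card (I \<inter> {C. D \<subseteq> C \<and> card C = m}))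
      = (\<Sum>D | card D = d. card {C \<in> {C \<in> I. card C = m}. D \<subseteq> C})"
    by (intro sum.cong arg_cong[where f = card]) auto
  also have "\<dots> = (m choose d) * card {C \<in> I. card C = m}"
  proof (rule sum_multicount)
    show "\<forall>C\<in>{C \<in> I. card C = m}. card {D \<in> {D. card D = d}. D \<subseteq> C} = m choose d"
    proof
      fix C
      assume "C \<in> {C \<in> I. card C = m}"
      moreover have "{D \<in> {D. card D = d}. D \<subseteq> C} = {D. D \<subseteq> C \<and> card D = d}"
        by auto
      ultimately show "card {D \<in> {D. card D = d}. D \<subseteq> C} = m choose d"
        by (simp add: n_subsets)
    qed
  qed auto
  also have "\<dots> \<le> (m choose d) * card I"
    by (intro mult_left_mono card_mono) auto
  finally show ?thesis
    by (simp add: mult.commute)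
qed

text \<open>The inequality with denominators cleared.  Everything is pulled back along the automorphism
  induced by \<open>F\<close>, which preserves dimensions, degrees and products.\<close>

lemma sum_dim_ext_proj_le:
  fixes F :: "real ^ 'n::{finite,linorder} ^ 'n::{finite,linorder}" and W :: "'n ext set"
  assumes "subspace W" "W \<subseteq> ext_power r" "invertible F"
  shows "(\<Sum>D | card D = d. dim (ext_proj F (- D) ` W))
    \<le> dim (wedge_space W (ext_power d)) * (r + d choose d)"
proof -
  define G where "G = matrix_inv F"
  define \<Phi> where "\<Phi> = ext_map ((*v) F)"
  define \<Psi> where "\<Psi> = ext_map ((*v) G)"
  have linF: "linear ((*v) F)" and linG: "linear ((*v) G)"
    by (rule matrix_vector_mul_linear)+
  have lin: "linear \<Phi>" "linear \<Psi>"
    unfolding \<Phi>_def \<Psi>_def by (rule linear_ext_map)+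
  have inv: "F ** G = mat 1" "G ** F = mat 1"
    using someI_ex[OF assms(3)[unfolded invertible_def]] by (simp_all add: G_def matrix_inv_def)
  have \<Phi>\<Psi>: "\<Phi> (\<Psi> w) = w" and \<Psi>\<Phi>: "\<Psi> (\<Phi> w) = w" for w
    unfolding \<Phi>_def \<Psi>_def
    by (intro ext_map_inverse linF linG, simp add: matrix_vector_mul_assoc inv)+
  have dim\<Phi>: "dim (\<Phi> ` X) = dim X" for X
    by (intro dim_image_eq lin inj_on_inverseI[of _ \<Psi>] \<Psi>\<Phi>)
  have dim\<Psi>: "dim (\<Psi> ` X) = dim X" for X
    by (intro dim_image_eq lin inj_on_inverseI[of _ \<Phi>] \<Phi>\<Psi>)
  define U where "U = wedge_space W (ext_power d)"
  define W' where "W' = \<Psi> ` W"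
  have W': "subspace W'" "W' \<subseteq> ext_power r"
    using assms(1,2) ext_map_in_ext_power[OF linG]
    by (auto simp: W'_def \<Psi>_def linear_subspace_image[OF linear_ext_map])
  have "subspace (\<Psi> ` U)"
    by (auto simp: U_def wedge_space_def intro: linear_subspace_image[OF lin(2)])
  then obtain I where cardI: "card I \<le> dim (\<Psi> ` U)"
    and I: "\<And>u. u \<in> \<Psi> ` U \<Longrightarrow> (\<And>C. C \<in> I \<Longrightarrow> u $ C = 0) \<Longrightarrow> u = 0"
    using determining_coordinates by blast
  have "dim (ext_proj F (- D) ` W) \<le> card (I \<inter> {C. D \<subseteq> C \<and> card C = r + d})"
    if D: "card D = d" for D
  proof -
    have "W = \<Phi> ` W'"
      by (simp add: W'_def image_image \<Phi>\<Psi>)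
    then have "ext_proj F (- D) ` W = \<Phi> ` restrict_ext (- D) ` W'"
      by (simp add: image_image \<Phi>_def ext_proj_ext_map[OF assms(3)])
    then have "dim (ext_proj F (- D) ` W) = dim (restrict_ext (- D) ` W')"
      by (simp add: dim\<Phi>)
    also have "\<dots> \<le> card (I \<inter> {C. D \<subseteq> C \<and> card C = r + d})"
    proof (rule dim_coordinate_proj_le[OF W' D], rule I)
      fix u
      assume "u \<in> W'"
      then obtain w where w: "w \<in> W" "u = \<Psi> w"
        by (auto simp: W'_def)
      have "axis D 1 \<in> ext_power d"
        using D by (auto simp: mem_ext_power_iff axis_def)
      then have "\<Phi> (axis D 1) \<in> ext_power d"
        unfolding \<Phi>_def by (rule ext_map_in_ext_power[OF linF])
      then have "w \<^bold>\<and> \<Phi> (axis D 1) \<in> U"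
        using w(1) unfolding U_def wedge_space_def by (intro span_base) blast
      moreover have "\<Psi> (w \<^bold>\<and> \<Phi> (axis D 1)) = u \<^bold>\<and> axis D 1"
        using \<Psi>\<Phi>[of "axis D 1"] by (simp add: w \<Psi>_def ext_map_wedge[OF linG])
      ultimately show "u \<^bold>\<and> axis D 1 \<in> \<Psi> ` U"
        by (metis imageI)
    qed
    finally show ?thesis .
  qed
  then have "(\<Sum>D | card D = d. dim (ext_proj F (- D) ` W))
      \<le> (\<Sum>D | card D = d. card (I \<inter> {C. D \<subseteq> C \<and> card C = r + d}))"
    by (intro sum_mono) auto
  also have "\<dots> \<le> card I * (r + d choose d)"
    by (rule sum_card_containing_le)
  also have "\<dots> \<le> dim U * (r + d choose d)"
    using cardI by (simp add: dim\<Psi>)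
  finally show ?thesis
    by (simp add: U_def)
qed

theorem lemma3p6:
  fixes F :: "real ^ 'n::{finite,linorder} ^ 'n::{finite,linorder}"
    and W :: "'n ext set"
    and r d :: nat
  assumes "0 < r" and "r + d \<le> CARD('n)"
    and "subspace W" and "W \<subseteq> ext_power r"
    and "invertible F"
  shows "real (dim (wedge_space W (ext_power d))) / real (CARD('n) choose (r + d))
    \<ge> 1 / real (CARD('n) choose (CARD('n) - d)) *
      (\<Sum>J | J \<subseteq> (UNIV :: 'n set) \<and> card J = CARD('n) - d.
        real (dim (ext_proj F J ` W)) / real ((CARD('n) - d) choose r))"
proof -
  let ?n = "CARD('n)"
  let ?U = "wedge_space W (ext_power d)"
  define s where "s = (\<Sum>D | card D = d. dim (ext_proj F (- D) ` W))"
  have card_Compl: "card (- A) = ?n - card A" for A :: "'n set"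
    by (simp add: Compl_eq_Diff_UNIV card_Diff_subset)
  have "(\<Sum>J | J \<subseteq> (UNIV :: 'n set) \<and> card J = ?n - d. real (dim (ext_proj F J ` W)))
      = (\<Sum>D | card D = d. real (dim (ext_proj F (- D) ` W)))"
    using assms(2)
    by (intro sum.reindex_bij_witness[of _ uminus uminus]) (auto simp: card_Compl)
  then have sum: "(\<Sum>J | J \<subseteq> (UNIV :: 'n set) \<and> card J = ?n - d.
      real (dim (ext_proj F J ` W)) / real ((?n - d) choose r)) = real s / real ((?n - d) choose r)"
    by (simp add: s_def flip: sum_divide_distrib)
  have choose: "real (?n choose (r + d)) * real (r + d choose d)
      = real (?n choose d) * real ((?n - d) choose r)"
    using choose_mult[of d "r + d" ?n] assms(2) by (simp flip: of_nat_mult)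
  have pos: "0 < real (?n choose (r + d))" "0 < real (?n choose d)" "0 < real ((?n - d) choose r)"
    using assms(2) by simp_all
  have "real s \<le> real (dim ?U) * real (r + d choose d)"
    using sum_dim_ext_proj_le[OF assms(3-5), of d]
    unfolding s_def of_nat_mult[symmetric] of_nat_le_iff .
  then have "real s * real (?n choose (r + d))
      \<le> real (dim ?U) * (real (?n choose (r + d)) * real (r + d choose d))"
    using pos(1) by (simp add: mult.assoc mult.commute mult_left_mono mult.left_commute)
  then have "real s / (real (?n choose d) * real ((?n - d) choose r))
      \<le> real (dim ?U) / real (?n choose (r + d))"
    unfolding choose using pos by (simp add: divide_simps mult_ac)
  moreover have "?n choose (?n - d) = ?n choose d"
    using assms(2) binomial_symmetric[of d ?n] by simp
  ultimately show ?thesis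
    unfolding sum by (simp add: mult.commute)
qed

end
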